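(* Let $f:[0,+\infty)\to[0,+\infty)$ be amenable. Then $f$ is (P)-preserving if and only if for every $K_1\geqslant 1$ there exists $K_2\geqslant 1$ such that $f$ maps every $K_1$-relaxed polygon to a $K_2$-relaxed polygon, i.e. such that for all $n\in\mathbb{N}$, $n\geqslant 1$, and all $a_1,\dots,a_n\in[0,+\infty)$, $$(1+K_1)\max_{1\leqslant i\leqslant n} a_i\leqslant K_1\sum_{i=1}^n a_i \quad\Longrightarrow\quad (1+K_2)\max_{1\leqslant i\leqslant n} f(a_i)\leqslant K_2\sum_{i=1}^n f(a_i).$$
   Context: A semimetric space is a non-empty set $X$ with a function $d:X\times X\to[0,+\infty)$ (a semimetric) such that for all $x,y\in X$: $d(x,y)=0$ iff $x=y$, and $d(x,y)=d(y,x)$. For $K\geqslant 1$, a semimetric space $(X,d)$ satisfies the $K$-relaxed polygonal inequality ($K$-rpi) if $d(x_0,x_n)\leqslant K\sum_{i=1}^n d(x_{i-1},x_i)$ for all $n\in\mathbb{N}$, $n\geqslant 1$, and all $x_0,\dots,x_n\in X$. It satisfies property (P) if it satisfies $K$-rpi for some $K\geqslant 1$. A function $f:[0,+\infty)\to[0,+\infty)$ is (P)-preserving if for every semimetric space $(X,d)$ satisfying (P), $f\circ d$ is a semimetric on $X$ and $(X,f\circ d)$ satisfies (P) (possibly with a different constant). $f$ is amenable if $f^{-1}[\{0\}]=\{0\}$. A finite tuple of non-negative reals is a $K$-relaxed polygon if, after sorting as $a_1\geqslant a_2\geqslant\dots\geqslant a_n$, one has $a_1\leqslant K\sum_{i=2}^n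 a_i$; equivalently, $(1+K)\max_i a_i\leqslant K\sum_{i=1}^n a_i$. *)

theory Defs
  imports Complex_Main "HOL-Library.Infinite_Typeclass"
begin

definition semimetric_space :: "'a set \<Rightarrow> ('a \<Rightarrow> 'a \<Rightarrow> real) \<Rightarrow> bool" where
  "semimetric_space X d \<longleftrightarrow>
     X \<noteq> {} \<and>
     (\<forall>x\<in>X. \<forall>y\<in>X. 0 \<le> d x y) \<and>
     (\<forall>x\<in>X. \<forall>y\<in>X. d x y = 0 \<longleftrightarrow> x = y) \<and>
     (\<forall>x\<in>X. \<forall>y\<in>X. d x y = d y x)"

definition relaxed_polygonal_ineq :: "real \<Rightarrow> 'a set \<Rightarrow> ('a \<Rightarrow> 'a \<Rightarrow> real) \<Rightarrow> bool" where
  "relaxed_polygonal_ineq K X d \<longleftrightarrow>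
     (\<forall>n\<ge>1. \<forall>x :: nat \<Rightarrow> 'a. (\<forall>i\<le>n. x i \<in> X) \<longrightarrow>
        d (x 0) (x n) \<le> K * (\<Sum>i=1..n. d (x (i - 1)) (x i)))"

definition property_P :: "'a set \<Rightarrow> ('a \<Rightarrow> 'a \<Rightarrow> real) \<Rightarrow> bool" where
  "property_P X d \<longleftrightarrow> (\<exists>K\<ge>1. relaxed_polygonal_ineq K X d)"

(* HOL cannot quantify over types inside a formula, so the universe from which
   the points of the spaces are drawn is an explicit type argument.
   X is an arbitrary nonempty subset of that universe, so an arbitrary infinite
   type provides the spaces of every cardinality up to its own; over a finite type
   every semimetric space satisfies (P) and the notion degenerates. *)
definition P_preserving :: "'a itself \<Rightarrow> (real \<Rightarrow> real) \<Rightarrow> bool" where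
  "P_preserving (_ :: 'a itself) f \<longleftrightarrow>
     (\<forall>(X :: 'a set) d. semimetric_space X d \<and> property_P X d \<longrightarrow>
        semimetric_space X (\<lambda>x y. f (d x y)) \<and> property_P X (\<lambda>x y. f (d x y)))"

(* A map from [0,\<infinity>) to [0,\<infinity>) is a total function on the reals of which
   only the values on {0..} are used. *)
definition amenable :: "(real \<Rightarrow> real) \<Rightarrow> bool" where
  "amenable f \<longleftrightarrow> {t \<in> {0..}. f t = 0} = {0}"

end

theory Submission
  imports Defs "HOL-Library.Countable"
begin

text \<open>
  If \<open>d\<close> satisfies the \<open>K\<close>-relaxed polygonal inequality, then the side lengths of every closed
  path form a \<open>K\<close>-relaxed polygon, because going around the path the other way bounds each side
  by \<open>K\<close> times the sum of all the others. If \<open>f\<close> maps relaxed polygons to relaxed polygons, the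
  images of the sides of a closed path therefore bound the image of its closing side, which is
  the polygonal inequality for \<open>f \<circ> d\<close>. This is \<open>relaxed_polygonal_ineq_comp\<close>.

  Conversely, let \<open>f\<close> preserve (P). Since \<open>f 0 = 0\<close> and
  \<open>f\<close> is nonnegative, it is enough to bound \<open>f c\<close> by a constant
  multiple of \<open>\<Sum> f(b)\<close>, uniformly over all \<open>c\<close> and all finite
  lists of \<open>b > 0\<close> with \<open>c \<le> K \<Sum> b\<close>. Such a list together with
  \<open>c\<close> becomes a relaxed polygon when every \<open>b\<close> is listed twice, as each
  \<open>b\<close> is then at most the sum of the other entries; this costs just a factor 2 in
  the conclusion. If there is no uniform bound (\<open>uniform_path_bound_pos\<close>), then for
  every \<open>m\<close> the bound with constant \<open>m + 1\<close> fails for some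
  \<open>c\<close> and some list. Place the vertices of the resulting polygon on a circle of
  length \<open>c + \<Sum> b\<close>, where the sums are over the doubled list. The arc length is
  a metric for which each side \<open>b\<close> has its prescribed length, and changing only the
  distance of the two end vertices to \<open>c\<close> distorts the metric by a factor at most
  \<open>K\<close>. So all these finite spaces satisfy the inequality with the same
  \<open>K\<close>, and so does their disjoint union with sufficiently large cross distances. The
  union is countable, hence embeds in every infinite type, and the constant for \<open>f \<circ>
  d\<close> on it contradicts the failure for large \<open>m\<close>.
\<close>


section \<open>Closed paths are relaxed polygons\<close>

lemma sum_periodic_shift:
  fixes g :: "nat \<Rightarrow> real"
  assumes "\<And>j. g (j + N) = g j"
  shows "(\<Sum>j<N. g (k + j)) = (\<Sum>j<N. g j)"
proof (induction k)
  case (Suc k)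
  have "(\<Sum>j<N. g (Suc k + j)) + g k = (\<Sum>j<Suc N. g (k + j))"
    by (subst sum.lessThan_Suc_shift) simp
  also have "\<dots> = (\<Sum>j<N. g (k + j)) + g k"
    by (simp add: assms)
  finally show ?case using Suc by simp
qed simp

text \<open>
  A closed path with \<open>n + 1\<close> vertices is encoded as a periodic sequence, so that starting just
  after a given side, traversing the \<open>n\<close> others and returning to its other end needs no case
  distinction on where the index wraps around.
\<close>
lemma closed_path_relaxed_polygon:
  fixes d :: "'a \<Rightarrow> 'a \<Rightarrow> real" and z :: "nat \<Rightarrow> 'a"
  assumes rpi: "relaxed_polygonal_ineq K X d"
    and sym: "\<And>x y. x \<in> X \<Longrightarrow> y \<in> X \<Longrightarrow> d x y = d y x"
    and z: "\<And>j. z j \<in> X" "\<And>j. z (j + Suc n) = z j" and "n \<ge> 1"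
  shows "(1 + K) * d (z k) (z (Suc k)) \<le> K * (\<Sum>j<Suc n. d (z j) (z (Suc j)))"
proof -
  define g where "g = (\<lambda>j. d (z j) (z (Suc j)))"
  have per: "g (j + Suc n) = g j" for j
    using z(2)[of j] z(2)[of "Suc j"] by (simp add: g_def)
  have "g k = d (z (Suc k + 0)) (z (Suc k + n))"
    using z(2)[of k] sym[OF z(1)[of k] z(1)[of "Suc k"]] by (simp add: g_def)
  also have "\<dots> \<le> K * (\<Sum>i=1..n. d (z (Suc k + (i - 1))) (z (Suc k + i)))"
    using rpi[unfolded relaxed_polygonal_ineq_def, rule_format, of n "\<lambda>i. z (Suc k + i)"]
      \<open>n \<ge> 1\<close> z(1) by simp
  also have "(\<Sum>i=1..n. d (z (Suc k + (i - 1))) (z (Suc k + i))) = (\<Sum>i<n. g (k + Suc i))"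
    by (intro sum.reindex_bij_witness[of _ Suc "\<lambda>i. i - 1"]) (auto simp: g_def)
  also have "\<dots> = (\<Sum>j<Suc n. g (k + j)) - g k"
    by (subst sum.lessThan_Suc_shift) simp
  also have "\<dots> = (\<Sum>j<Suc n. g j) - g k"
    by (simp only: sum_periodic_shift[of g, OF per])
  finally show ?thesis by (simp add: g_def algebra_simps)
qed

lemma relaxed_polygonal_ineq_comp:
  fixes f :: "real \<Rightarrow> real"
  assumes sm: "semimetric_space X d" and rpi: "relaxed_polygonal_ineq K\<^sub>1 X d"
    and poly: "\<And>(n :: nat) a. n \<ge> 1 \<Longrightarrow> \<forall>i\<in>{1..n}. 0 \<le> a i \<Longrightarrow>
       (1 + K\<^sub>1) * (MAX i\<in>{1..n}. a i) \<le> K\<^sub>1 * (\<Sum>i=1..n. a i) \<Longrightarrow>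
       (1 + K\<^sub>2) * (MAX i\<in>{1..n}. f (a i)) \<le> K\<^sub>2 * (\<Sum>i=1..n. f (a i))"
    and K: "K\<^sub>1 \<ge> 1" "K\<^sub>2 \<ge> 1"
  shows "relaxed_polygonal_ineq K\<^sub>2 X (\<lambda>x y. f (d x y))"
  unfolding relaxed_polygonal_ineq_def
proof (intro allI impI)
  fix n :: nat and x :: "nat \<Rightarrow> 'a"
  assume n: "1 \<le> n" and x: "\<forall>i\<le>n. x i \<in> X"
  have sym: "\<And>x y. x \<in> X \<Longrightarrow> y \<in> X \<Longrightarrow> d x y = d y x"
    and nonneg: "\<And>x y. x \<in> X \<Longrightarrow> y \<in> X \<Longrightarrow> d x y \<ge> 0"
    using sm by (auto simp: semimetric_space_def)
  define z where "z = (\<lambda>j. x (j mod Suc n))"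
  have zX: "z j \<in> X" for j
    using x mod_less_divisor[of "Suc n" j] by (auto simp: z_def less_Suc_eq_le simp del: mod_less_divisor)
  have zper: "z (j + Suc n) = z j" for j
    unfolding z_def by (simp only: mod_add_self2)
  have zx: "z i = x i" if "i \<le> n" for i
    using that by (simp add: z_def)
  have z0: "z (Suc n) = x 0"
    by (simp add: z_def)
  \<comment> \<open>The last entry, \<open>a (Suc n)\<close>, is the side from \<open>x n\<close> back to \<open>x 0\<close>.\<close>
  define a where "a = (\<lambda>i. d (z (i - 1)) (z i))"
  have shift: "(\<Sum>i=1..Suc n. h (a i)) = (\<Sum>j<Suc n. h (d (z j) (z (Suc j))))" for h :: "real \<Rightarrow> real"
    by (intro sum.reindex_bij_witness[of _ Suc "\<lambda>i. i - 1"]) (auto simp: a_def)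
  have "(1 + K\<^sub>1) * (MAX i\<in>{1..Suc n}. a i) \<le> K\<^sub>1 * (\<Sum>i=1..Suc n. a i)"
  proof -
    have "(MAX i\<in>{1..Suc n}. a i) \<in> a ` {1..Suc n}"
      by (intro Max_in) auto
    then obtain k where k: "k \<in> {1..Suc n}" "(MAX i\<in>{1..Suc n}. a i) = a k"
      by (elim imageE)
    have "(1 + K\<^sub>1) * d (z (k - 1)) (z (Suc (k - 1))) \<le> K\<^sub>1 * (\<Sum>j<Suc n. d (z j) (z (Suc j)))"
      by (rule closed_path_relaxed_polygon[where z = z, OF rpi sym zX zper n])
    then show ?thesis
      using k shift[of "\<lambda>t. t"] by (simp add: a_def)
  qed
  moreover have "\<forall>i\<in>{1..Suc n}. 0 \<le> a i"
    by (simp add: a_def nonneg zX)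
  ultimately have "(1 + K\<^sub>2) * (MAX i\<in>{1..Suc n}. f (a i)) \<le> K\<^sub>2 * (\<Sum>i=1..Suc n. f (a i))"
    by (intro poly) auto
  moreover have "f (a (Suc n)) \<le> (MAX i\<in>{1..Suc n}. f (a i))"
    by (intro Max_ge) auto
  then have "(1 + K\<^sub>2) * f (a (Suc n)) \<le> (1 + K\<^sub>2) * (MAX i\<in>{1..Suc n}. f (a i))"
    using K by (intro mult_left_mono) auto
  ultimately have "(1 + K\<^sub>2) * f (a (Suc n)) \<le> K\<^sub>2 * (\<Sum>i=1..n. f (a i)) + K\<^sub>2 * f (a (Suc n))"
    by (simp add: algebra_simps)
  moreover have "a (Suc n) = d (x 0) (x n)"
    using sym x by (simp add: a_def zx z0)
  moreover have "(\<Sum>i=1..n. f (a i)) = (\<Sum>i=1..n. f (d (x (i - 1)) (x i)))"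
    by (intro sum.cong) (auto simp: a_def zx)
  ultimately show "f (d (x 0) (x n)) \<le> K\<^sub>2 * (\<Sum>i=1..n. f (d (x (i - 1)) (x i)))"
    by (simp add: algebra_simps)
qed


section \<open>Semimetrics close to metrics, and gluing\<close>

text \<open>
  The relaxed polygonal inequality is insensitive to bounded distortion of a metric; this supplies
  one constant for infinitely many spaces at once.
\<close>
lemma relaxed_polygonal_ineq_if_near_metric:
  fixes \<rho> d :: "'a \<Rightarrow> 'a \<Rightarrow> real"
  assumes tri: "\<And>x y z. x \<in> X \<Longrightarrow> y \<in> X \<Longrightarrow> z \<in> X \<Longrightarrow> \<rho> x z \<le> \<rho> x y + \<rho> y z"
    and lo: "\<And>x y. x \<in> X \<Longrightarrow> y \<in> X \<Longrightarrow> \<rho> x y \<le> d x y"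
    and hi: "\<And>x y. x \<in> X \<Longrightarrow> y \<in> X \<Longrightarrow> d x y \<le> K * \<rho> x y"
    and K: "K \<ge> 0"
  shows "relaxed_polygonal_ineq K X d"
  unfolding relaxed_polygonal_ineq_def
proof (intro allI impI)
  fix n :: nat and x :: "nat \<Rightarrow> 'a"
  assume n: "1 \<le> n" and x: "\<forall>i\<le>n. x i \<in> X"
  have "m \<le> n \<Longrightarrow> \<rho> (x 0) (x m) \<le> (\<Sum>i=1..m. d (x (i - 1)) (x i))" if "1 \<le> m" for m
    using that
  proof (induction m rule: dec_induct)
    case base
    then show ?case using lo x by simp
  next
    case (step m)
    have "\<rho> (x 0) (x (Suc m)) \<le> \<rho> (x 0) (x m) + \<rho> (x m) (x (Suc m))"
      using step x by (intro tri) auto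
    also have "\<rho> (x m) (x (Suc m)) \<le> d (x m) (x (Suc m))"
      using step x by (intro lo) auto
    finally show ?case using step by simp
  qed
  from this[OF n] have "K * \<rho> (x 0) (x n) \<le> K * (\<Sum>i=1..n. d (x (i - 1)) (x i))"
    using K by (intro mult_left_mono) auto
  with hi[of "x 0" "x n"] x show "d (x 0) (x n) \<le> K * (\<Sum>i=1..n. d (x (i - 1)) (x i))"
    by force
qed

text \<open>
  Disjoint union of spaces indexed by \<open>m\<close>. With \<open>L m\<close> at least the diameter of the \<open>m\<close>-th space,
  the maximum keeps the triangle inequality: two points of the same space are at most \<open>L m\<close> apart,
  and a detour through another space costs at least \<open>2 * L m\<close>.
\<close>
definition glued :: "('i \<Rightarrow> real) \<Rightarrow> ('i \<Rightarrow> 'b \<Rightarrow> 'b \<Rightarrow> real) \<Rightarrow> 'i \<times> 'b \<Rightarrow> 'i \<times> 'b \<Rightarrow> real" where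
  "glued L \<rho> x y =
     (if fst x = fst y then \<rho> (fst x) (snd x) (snd y) else max (L (fst x)) (L (fst y)))"

lemma semimetric_space_glued:
  assumes "I \<noteq> {}" and "\<And>m. m \<in> I \<Longrightarrow> semimetric_space (Y m) (d m)" and "\<And>m. m \<in> I \<Longrightarrow> L m > 0"
  shows "semimetric_space (Sigma I Y) (glued L d)"
  using assms unfolding semimetric_space_def glued_def
  by (auto simp: max_def dest: less_imp_le) fastforce+

lemma relaxed_polygonal_ineq_glued:
  assumes L: "\<And>m. m \<in> I \<Longrightarrow> L m > 0"
    and tri: "\<And>m i j k. m \<in> I \<Longrightarrow> i \<in> Y m \<Longrightarrow> j \<in> Y m \<Longrightarrow> k \<in> Y m \<Longrightarrow> \<rho> m i k \<le> \<rho> m i j + \<rho> m j k"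
    and nonneg: "\<And>m i j. m \<in> I \<Longrightarrow> i \<in> Y m \<Longrightarrow> j \<in> Y m \<Longrightarrow> 0 \<le> \<rho> m i j"
    and diam: "\<And>m i j. m \<in> I \<Longrightarrow> i \<in> Y m \<Longrightarrow> j \<in> Y m \<Longrightarrow> \<rho> m i j \<le> L m"
    and lo: "\<And>m i j. m \<in> I \<Longrightarrow> i \<in> Y m \<Longrightarrow> j \<in> Y m \<Longrightarrow> \<rho> m i j \<le> d m i j"
    and hi: "\<And>m i j. m \<in> I \<Longrightarrow> i \<in> Y m \<Longrightarrow> j \<in> Y m \<Longrightarrow> d m i j \<le> K * \<rho> m i j"
    and K: "K \<ge> 1"
  shows "relaxed_polygonal_ineq K (Sigma I Y) (glued L d)"
proof (rule relaxed_polygonal_ineq_if_near_metric[where \<rho> = "glued L \<rho>"])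
  fix x y z assume "x \<in> Sigma I Y" "y \<in> Sigma I Y" "z \<in> Sigma I Y"
  then obtain m i m' j m'' k where
    "x = (m, i)" "y = (m', j)" "z = (m'', k)" "m \<in> I" "m' \<in> I" "m'' \<in> I"
    "i \<in> Y m" "j \<in> Y m'" "k \<in> Y m''" by auto
  then show "glued L \<rho> x z \<le> glued L \<rho> x y + glued L \<rho> y z"
    using L[of m] L[of m'] L[of m''] tri[of m i j k] diam[of m i k] nonneg[of m i j] nonneg[of m' j k]
    by (auto simp: glued_def max_def)
next
  fix x y assume "x \<in> Sigma I Y" "y \<in> Sigma I Y"
  then show "glued L \<rho> x y \<le> glued L d x y"
    using lo by (auto simp: glued_def)
next
  fix x y assume xy: "x \<in> Sigma I Y" "y \<in> Sigma I Y"
  define M where "M = max (L (fst x)) (L (fst y))"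
  have "0 \<le> M" using xy L by (auto simp: M_def le_max_iff_disj less_imp_le)
  then have "1 * M \<le> K * M" using K by (intro mult_right_mono)
  then show "glued L d x y \<le> K * glued L \<rho> x y"
    using hi xy by (auto simp: glued_def M_def)
qed (use K in simp)

text \<open>
  Being (P)-preserving over an infinite type covers the spaces with points in any countable type,
  by transport along an injection. Counterexamples can thus be indexed by numbers.
\<close>
lemma P_preserving_countable:
  fixes f :: "real \<Rightarrow> real" and Y :: "'b :: countable set"
  assumes pres: "P_preserving TYPE('a :: infinite) f"
    and sm: "semimetric_space Y d" and P: "property_P Y d"
  shows "property_P Y (\<lambda>x y. f (d x y))"
proof -
  obtain e :: "nat \<Rightarrow> 'a" where "inj e"
    using infinite_countable_subset[OF infinite_UNIV] by blast
  define h where "h = e \<circ> (to_nat :: 'b \<Rightarrow> nat)"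
  have "inj h" unfolding h_def by (intro inj_compose \<open>inj e\<close> inj_to_nat)
  then have [simp]: "inv h (h y) = y" for y by simp
  define d' where "d' = (\<lambda>x y. d (inv h x) (inv h y))"
  have pull: "relaxed_polygonal_ineq K (h ` Y) (\<lambda>x y. g (d' x y)) \<longleftrightarrow>
      relaxed_polygonal_ineq K Y (\<lambda>x y. g (d x y))" for K and g :: "real \<Rightarrow> real"
  proof
    assume A: "relaxed_polygonal_ineq K Y (\<lambda>x y. g (d x y))"
    show "relaxed_polygonal_ineq K (h ` Y) (\<lambda>x y. g (d' x y))"
      unfolding relaxed_polygonal_ineq_def
    proof (intro allI impI)
      fix n :: nat and x assume "1 \<le> n" "\<forall>i\<le>n. x i \<in> h ` Y"
      moreover from this have "\<forall>i\<le>n. inv h (x i) \<in> Y" by force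
      ultimately show "g (d' (x 0) (x n)) \<le> K * (\<Sum>i=1..n. g (d' (x (i - 1)) (x i)))"
        using A[unfolded relaxed_polygonal_ineq_def, rule_format, of n "\<lambda>i. inv h (x i)"]
        by (simp add: d'_def)
    qed
  next
    assume A: "relaxed_polygonal_ineq K (h ` Y) (\<lambda>x y. g (d' x y))"
    show "relaxed_polygonal_ineq K Y (\<lambda>x y. g (d x y))"
      unfolding relaxed_polygonal_ineq_def
    proof (intro allI impI)
      fix n :: nat and x assume "1 \<le> n" "\<forall>i\<le>n. x i \<in> Y"
      then show "g (d (x 0) (x n)) \<le> K * (\<Sum>i=1..n. g (d (x (i - 1)) (x i)))"
        using A[unfolded relaxed_polygonal_ineq_def, rule_format, of n "\<lambda>i. h (x i)"]
        by (simp add: d'_def)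
    qed
  qed
  have "semimetric_space (h ` Y) d'"
    using sm \<open>inj h\<close> by (auto simp: semimetric_space_def d'_def inj_eq)
  moreover have "property_P (h ` Y) d'"
    using P pull[where g = "\<lambda>t. t"] by (simp add: property_P_def)
  ultimately have "property_P (h ` Y) (\<lambda>x y. f (d' x y))"
    using pres by (simp add: P_preserving_def)
  then show ?thesis
    using pull[where g = f] by (simp add: property_P_def)
qed


section \<open>Polygons inscribed in a circle\<close>

text \<open>
  Arc length on a circle of length \<open>L\<close>, in coordinates from \<open>{0..L}\<close>.
\<close>
definition circle_dist :: "real \<Rightarrow> real \<Rightarrow> real \<Rightarrow> real" where
  "circle_dist L p q = min \<bar>p - q\<bar> (L - \<bar>p - q\<bar>)"

lemma circle_dist_triangle:
  assumes "p \<in> {0..L}" "q \<in> {0..L}" "r \<in> {0..L}"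
  shows "circle_dist L p r \<le> circle_dist L p q + circle_dist L q r"
  using assms unfolding circle_dist_def min_def abs_if by auto

definition vertex :: "real list \<Rightarrow> nat \<Rightarrow> real" where
  "vertex bs i = sum_list (take i bs)"

lemma vertex_Suc: "i < length bs \<Longrightarrow> vertex bs (Suc i) = vertex bs i + bs ! i"
  by (simp add: vertex_def take_Suc_conv_app_nth)

text \<open>
  A polygon with sides \<open>bs\<close> and closing side \<open>c\<close> is laid out around a circle whose length is its
  perimeter. Arc length need not reproduce \<open>c\<close> between the two end vertices when \<open>c\<close> exceeds the
  sum of \<open>bs\<close>, so the semimetric overrides that one distance.
\<close>
definition polygon_metric :: "real \<Rightarrow> real list \<Rightarrow> nat \<Rightarrow> nat \<Rightarrow> real" where
  "polygon_metric c bs i j = circle_dist (c + sum_list bs) (vertex bs i) (vertex bs j)"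

definition polygon_semimetric :: "real \<Rightarrow> real list \<Rightarrow> nat \<Rightarrow> nat \<Rightarrow> real" where
  "polygon_semimetric c bs i j =
     (if {i, j} = {0, length bs} then c else polygon_metric c bs i j)"

lemma polygon_metric_commute: "polygon_metric c bs i j = polygon_metric c bs j i"
  by (simp add: polygon_metric_def circle_dist_def abs_minus_commute)

lemma polygon_metric_le_circumference: "polygon_metric c bs i j \<le> c + sum_list bs"
  by (auto simp: polygon_metric_def circle_dist_def)

lemma polygon_semimetric_ends: "polygon_semimetric c bs 0 (length bs) = c"
  by (simp add: polygon_semimetric_def)

context
  fixes c :: real and bs :: "real list"
  assumes c: "c > 0" and bs: "\<forall>b\<in>set bs. b > 0"
begin

lemma vertex_strict_mono:
  assumes "i < j" "j \<le> length bs"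
  shows "vertex bs i < vertex bs j"
proof -
  have "Suc i \<le> j" using assms by simp
  then show ?thesis using assms(2)
  proof (induction j rule: dec_induct)
    case base
    then show ?case using bs by (simp add: vertex_Suc)
  next
    case (step j)
    then have "bs ! j > 0" using bs by simp
    with step show ?case by (simp add: vertex_Suc)
  qed
qed

lemma vertex_eq_iff:
  "i \<le> length bs \<Longrightarrow> j \<le> length bs \<Longrightarrow> vertex bs i = vertex bs j \<longleftrightarrow> i = j"
  using vertex_strict_mono[of i j] vertex_strict_mono[of j i] by (cases i j rule: linorder_cases) auto

lemma vertex_range:
  assumes "i \<le> length bs"
  shows "0 \<le> vertex bs i" and "vertex bs i \<le> sum_list bs"
  using vertex_strict_mono[of 0 i] vertex_strict_mono[of i "length bs"] assms
  by (cases "i = 0"; cases "i = length bs"; simp add: vertex_def)+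

lemma polygon_metric_triangle:
  assumes "i \<le> length bs" "j \<le> length bs" "k \<le> length bs"
  shows "polygon_metric c bs i k \<le> polygon_metric c bs i j + polygon_metric c bs j k"
  unfolding polygon_metric_def using assms c vertex_range
  by (intro circle_dist_triangle) (auto simp: add_increasing less_imp_le)

lemma polygon_metric_nonneg:
  assumes "i \<le> length bs" "j \<le> length bs"
  shows "0 \<le> polygon_metric c bs i j"
  using vertex_range[OF assms(1)] vertex_range[OF assms(2)] c
  by (auto simp: polygon_metric_def circle_dist_def)

lemma polygon_metric_eq_0_iff:
  assumes "i \<le> length bs" "j \<le> length bs"
  shows "polygon_metric c bs i j = 0 \<longleftrightarrow> i = j"
  using vertex_range[OF assms(1)] vertex_range[OF assms(2)] c vertex_eq_iff[OF assms]
  by (auto simp: polygon_metric_def circle_dist_def min_def)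

lemma polygon_metric_ends:
  "{i, j} = {0, length bs} \<Longrightarrow> polygon_metric c bs i j = min (sum_list bs) c"
  using vertex_range[of "length bs"]
  by (auto simp: polygon_metric_def circle_dist_def vertex_def doubleton_eq_iff)

lemma semimetric_space_polygon:
  assumes "bs \<noteq> []"
  shows "semimetric_space {..length bs} (polygon_semimetric c bs)"
  unfolding semimetric_space_def polygon_semimetric_def
  using c assms polygon_metric_nonneg polygon_metric_eq_0_iff polygon_metric_commute
  by (auto simp: doubleton_eq_iff)

lemma polygon_semimetric_ge_metric:
  "polygon_metric c bs i j \<le> polygon_semimetric c bs i j"
  using polygon_metric_ends by (auto simp: polygon_semimetric_def)

lemma polygon_semimetric_le_metric:
  assumes K: "K \<ge> 1" and cK: "c \<le> K * sum_list bs" and ij: "i \<le> length bs" "j \<le> length bs"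
  shows "polygon_semimetric c bs i j \<le> K * polygon_metric c bs i j"
proof (cases "{i, j} = {0, length bs}")
  case True
  have "1 * c \<le> K * c" using K c by (intro mult_right_mono) auto
  then show ?thesis
    using True cK polygon_metric_ends[OF True] by (simp add: polygon_semimetric_def min_def)
next
  case False
  have "1 * polygon_metric c bs i j \<le> K * polygon_metric c bs i j"
    using K polygon_metric_nonneg[OF ij] by (intro mult_right_mono) auto
  then show ?thesis using False by (simp add: polygon_semimetric_def)
qed

text \<open>
  A side is realised exactly if it is no longer than the complementary arc. With at least two
  sides, none of them joins the two end vertices, where the distance was overridden.
\<close>
lemma polygon_semimetric_side:
  assumes i: "i < length bs" and len: "length bs \<ge> 2" and short: "2 * bs ! i \<le> sum_list bs"
  shows "polygon_semimetric c bs i (Suc i) = bs ! i"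
proof -
  have "bs ! i > 0" using bs i by simp
  then show ?thesis
    using i len short c
    by (auto simp: polygon_semimetric_def polygon_metric_def circle_dist_def vertex_Suc
        doubleton_eq_iff)
qed

end


section \<open>Relaxed polygons are mapped to relaxed polygons\<close>

text \<open>
  The constant \<open>M\<close> has to serve all lists at once, while (P) gives one constant for each space.
  This is why the counterexamples for all \<open>m\<close> are put into a single space.
\<close>
lemma uniform_path_bound_pos:
  fixes f :: "real \<Rightarrow> real"
  assumes pres: "P_preserving TYPE('a :: infinite) f"
    and nonneg: "\<And>t. t \<ge> 0 \<Longrightarrow> f t \<ge> 0" and K: "K \<ge> 1"
  shows "\<exists>M\<ge>1. \<forall>c bs. c > 0 \<longrightarrow> (\<forall>b\<in>set bs. b > 0) \<longrightarrow> c \<le> K * sum_list bs \<longrightarrow>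
           f c \<le> M * sum_list (map f bs)"
proof (rule ccontr)
  assume no_bound: "\<not> ?thesis"
  have "\<exists>c bs. c > 0 \<and> (\<forall>b\<in>set bs. b > 0) \<and> c \<le> K * sum_list bs \<and>
          \<not> f c \<le> real (Suc m) * sum_list (map f bs)" for m
    using no_bound[unfolded not_ex de_Morgan_conj, rule_format, of "real (Suc m)"] by auto
  then obtain c bs where c: "\<And>m. c m > 0" and bs: "\<And>m. \<forall>b\<in>set (bs m). b > 0"
    and cK: "\<And>m. c m \<le> K * sum_list (bs m)"
    and bad: "\<And>m. \<not> f (c m) \<le> real (Suc m) * sum_list (map f (bs m))"
    by metis
  \<comment> \<open>Doubling makes every side at most the sum of the other ones, and rules out a polygon with
    only one side besides the closing one.\<close>
  define es where "es = (\<lambda>m. bs m @ bs m)"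
  have es: "\<forall>b\<in>set (es m). b > 0" for m
    using bs by (auto simp: es_def)
  have bs_pos: "sum_list (bs m) > 0" for m
    using c[of m] cK[of m] K by (smt (verit) mult_nonneg_nonpos)
  then have "bs m \<noteq> []" for m by (metis less_irrefl sum_list.Nil)
  then have len: "length (es m) \<ge> 2" for m
    by (cases "bs m") (auto simp: es_def)
  have es_ne: "es m \<noteq> []" for m
    using len[of m] by (cases "es m") auto
  have "K * sum_list (bs m) \<le> K * sum_list (es m)" for m
    using K bs_pos[of m] by (intro mult_left_mono) (auto simp: es_def)
  then have cK': "c m \<le> K * sum_list (es m)" for m
    using cK order_trans by blast
  have short: "2 * es m ! i \<le> sum_list (es m)" if "i < length (es m)" for m i
  proof -
    have "es m ! i \<in> set (bs m)" using that nth_mem[of i "es m"] by (simp add: es_def)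
    then have "es m ! i \<le> sum_list (bs m)"
      using bs[of m] by (intro member_le_sum_list) (auto simp: less_imp_le)
    then show ?thesis by (simp add: es_def)
  qed
  define L where "L = (\<lambda>m. c m + sum_list (es m))"
  have L: "L m > 0" for m
    using c[of m] bs_pos[of m] by (simp add: L_def es_def)
  define Y where "Y = Sigma UNIV (\<lambda>m. {..length (es m)})"
  define d where "d = glued L (\<lambda>m. polygon_semimetric (c m) (es m))"
  have "semimetric_space Y d"
    unfolding Y_def d_def
    by (intro semimetric_space_glued semimetric_space_polygon c es es_ne L) auto
  moreover have "relaxed_polygonal_ineq K Y d"
    unfolding Y_def d_def
    by (rule relaxed_polygonal_ineq_glued[where \<rho> = "\<lambda>m. polygon_metric (c m) (es m)"])
      (use L K in \<open>simp_all add: polygon_metric_triangle[OF c es] polygon_metric_nonneg[OF c es]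
        polygon_metric_le_circumference L_def polygon_semimetric_ge_metric[OF c es]
        polygon_semimetric_le_metric[OF c es K cK']\<close>)
  then have "property_P Y d"
    using K by (auto simp: property_P_def)
  ultimately have "property_P Y (\<lambda>x y. f (d x y))"
    by (rule P_preserving_countable[OF pres])
  then obtain K' where K': "K' \<ge> 1" "relaxed_polygonal_ineq K' Y (\<lambda>x y. f (d x y))"
    by (auto simp: property_P_def)
  obtain m :: nat where m: "2 * K' \<le> real m"
    using real_arch_simple by blast
  define N where "N = length (es m)"
  have "f (c m) = f (d (m, 0) (m, N))"
    by (simp add: d_def glued_def N_def polygon_semimetric_ends)
  also have "\<dots> \<le> K' * (\<Sum>i=1..N. f (d (m, i - 1) (m, i)))"
    using K'(2)[unfolded relaxed_polygonal_ineq_def, rule_format, of N "\<lambda>i. (m, i)"] len[of m]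
    by (simp add: N_def Y_def)
  also have "(\<Sum>i=1..N. f (d (m, i - 1) (m, i))) = (\<Sum>i<N. f (d (m, i) (m, Suc i)))"
    by (intro sum.reindex_bij_witness[of _ Suc "\<lambda>i. i - 1"]) auto
  also have "\<dots> = (\<Sum>i<N. f (es m ! i))"
    by (intro sum.cong) (simp_all add: d_def glued_def N_def
        polygon_semimetric_side[OF c es _ len short])
  also have "\<dots> = sum_list (map f (es m))"
    by (simp add: sum_list_sum_nth N_def atLeast0LessThan)
  also have "\<dots> = 2 * sum_list (map f (bs m))"
    by (simp add: es_def)
  also have "K' * \<dots> = (2 * K') * sum_list (map f (bs m))"
    by simp
  also have "\<dots> \<le> real (Suc m) * sum_list (map f (bs m))"
    using m bs[of m] nonneg by (intro mult_right_mono sum_list_nonneg) (auto simp: less_imp_le)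
  finally show False using bad by blast
qed

text \<open>
  Zero lengths would identify vertices, so they are removed; since \<open>f 0 = 0\<close> they do not contribute
  to either sum.
\<close>
lemma uniform_path_bound:
  fixes f :: "real \<Rightarrow> real"
  assumes pres: "P_preserving TYPE('a :: infinite) f"
    and nonneg: "\<And>t. t \<ge> 0 \<Longrightarrow> f t \<ge> 0" and f0: "f 0 = 0" and K: "K \<ge> 1"
  obtains M where "M \<ge> 1"
    and "\<And>c bs. c \<ge> 0 \<Longrightarrow> \<forall>b\<in>set bs. b \<ge> 0 \<Longrightarrow> c \<le> K * sum_list bs \<Longrightarrow>
           f c \<le> M * sum_list (map f bs)"
proof -
  obtain M where M: "M \<ge> 1"
    and bound: "\<And>c bs. c > 0 \<Longrightarrow> \<forall>b\<in>set bs. b > 0 \<Longrightarrow> c \<le> K * sum_list bs \<Longrightarrow>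
           f c \<le> M * sum_list (map f bs)"
    using uniform_path_bound_pos[OF pres nonneg K] by metis
  show thesis
  proof (rule that[OF M])
    fix c :: real and bs
    assume A: "c \<ge> 0" "\<forall>b\<in>set bs. b \<ge> 0" "c \<le> K * sum_list bs"
    let ?bs = "filter (\<lambda>b. b > 0) bs"
    have drop: "sum_list (map g bs) = sum_list (map g ?bs)" if "g 0 = 0" for g :: "real \<Rightarrow> real"
      using A(2) that by (induction bs) auto
    show "f c \<le> M * sum_list (map f bs)"
    proof (cases "c = 0")
      case True
      then show ?thesis
        using f0 M A(2) nonneg by (auto intro!: mult_nonneg_nonneg sum_list_nonneg)
    next
      case False
      then have "f c \<le> M * sum_list (map f ?bs)"
        using A drop[of "\<lambda>t. t"] by (intro bound) auto
      then show ?thesis by (simp add: drop[of f] f0)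
    qed
  qed
qed

text \<open>
  The path bound is applied to the entry with the largest image, which need not be the largest
  entry itself: in a relaxed polygon every entry is at most \<open>K\<^sub>1\<close> times the sum of the others.
\<close>
lemma relaxed_polygon_image:
  fixes f :: "real \<Rightarrow> real" and a :: "nat \<Rightarrow> real"
  assumes "K\<^sub>1 \<ge> 1" "K\<^sub>2 \<ge> 1"
    and bound: "\<And>c bs. c \<ge> 0 \<Longrightarrow> \<forall>b\<in>set bs. b \<ge> 0 \<Longrightarrow> c \<le> K\<^sub>1 * sum_list bs \<Longrightarrow>
           f c \<le> K\<^sub>2 * sum_list (map f bs)"
    and n: "n \<ge> 1" and a: "\<forall>i\<in>{1..n}. 0 \<le> a i"
    and poly: "(1 + K\<^sub>1) * (MAX i\<in>{1..n}. a i) \<le> K\<^sub>1 * (\<Sum>i=1..n. a i)"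
  shows "(1 + K\<^sub>2) * (MAX i\<in>{1..n}. f (a i)) \<le> K\<^sub>2 * (\<Sum>i=1..n. f (a i))"
proof -
  have "(MAX i\<in>{1..n}. f (a i)) \<in> (\<lambda>i. f (a i)) ` {1..n}"
    using n by (intro Max_in) auto
  then obtain k where k: "k \<in> {1..n}" and maxk: "(MAX i\<in>{1..n}. f (a i)) = f (a k)"
    by auto
  define I where "I = {1..n} - {k}"
  have split: "(\<Sum>i=1..n. g i) = g k + sum g I" for g :: "nat \<Rightarrow> real"
    using k by (simp add: I_def sum.remove)
  define bs where "bs = map a (sorted_list_of_set I)"
  have sums: "sum_list (map g bs) = (\<Sum>i\<in>I. g (a i))" for g :: "real \<Rightarrow> real"
    by (simp add: bs_def sum_list_distinct_conv_sum_set comp_def I_def)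
  have "a k \<le> (MAX i\<in>{1..n}. a i)"
    using k by (intro Max_ge) auto
  then have "(1 + K\<^sub>1) * a k \<le> (1 + K\<^sub>1) * (MAX i\<in>{1..n}. a i)"
    using assms(1) by (intro mult_left_mono) auto
  with poly have "a k \<le> K\<^sub>1 * sum_list bs"
    using sums[of "\<lambda>t. t"] by (simp only: split[of a]) (simp add: algebra_simps)
  then have "f (a k) \<le> K\<^sub>2 * sum_list (map f bs)"
    using a k by (intro bound) (auto simp: bs_def I_def)
  then show ?thesis
    by (simp only: maxk split[of "\<lambda>i. f (a i)"] sums) (simp add: algebra_simps)
qed

theorem theorem5p1:
  fixes f :: "real \<Rightarrow> real"
  assumes "\<And>t. t \<ge> 0 \<Longrightarrow> f t \<ge> 0"
    and "amenable f"
  shows "P_preserving TYPE('a :: infinite) f \<longleftrightarrow>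
    (\<forall>K\<^sub>1\<ge>1. \<exists>K\<^sub>2\<ge>1. \<forall>n\<ge>1. \<forall>a :: nat \<Rightarrow> real.
       (\<forall>i\<in>{1..n}. 0 \<le> a i) \<longrightarrow>
       (1 + K\<^sub>1) * (MAX i\<in>{1..n}. a i) \<le> K\<^sub>1 * (\<Sum>i=1..n. a i) \<longrightarrow>
       (1 + K\<^sub>2) * (MAX i\<in>{1..n}. f (a i)) \<le> K\<^sub>2 * (\<Sum>i=1..n. f (a i)))"
    (is "_ \<longleftrightarrow> (\<forall>K\<^sub>1\<ge>1. \<exists>K\<^sub>2\<ge>1. ?maps K\<^sub>1 K\<^sub>2)")
proof -
  have f0: "f t = 0 \<longleftrightarrow> t = 0" if "t \<ge> 0" for t
    using assms(2) that unfolding amenable_def by auto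
  show ?thesis
  proof (intro iffI allI impI)
    fix K\<^sub>1 :: real
    assume pres: "P_preserving TYPE('a) f" and K\<^sub>1: "K\<^sub>1 \<ge> 1"
    obtain K\<^sub>2 where "K\<^sub>2 \<ge> 1" and
      "\<And>c bs. c \<ge> 0 \<Longrightarrow> \<forall>b\<in>set bs. b \<ge> 0 \<Longrightarrow> c \<le> K\<^sub>1 * sum_list bs \<Longrightarrow>
           f c \<le> K\<^sub>2 * sum_list (map f bs)"
      using uniform_path_bound[OF pres assms(1) _ K\<^sub>1] f0 by auto
    then have "?maps K\<^sub>1 K\<^sub>2"
      using relaxed_polygon_image[of K\<^sub>1 K\<^sub>2 f] K\<^sub>1 by blast
    with \<open>K\<^sub>2 \<ge> 1\<close> show "\<exists>K\<^sub>2\<ge>1. ?maps K\<^sub>1 K\<^sub>2" by blast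
  next
    assume maps: "\<forall>K\<^sub>1\<ge>1. \<exists>K\<^sub>2\<ge>1. ?maps K\<^sub>1 K\<^sub>2"
    show "P_preserving TYPE('a) f"
      unfolding P_preserving_def
    proof (intro allI impI)
      fix X :: "'a set" and d
      assume "semimetric_space X d \<and> property_P X d"
      then obtain K\<^sub>1 where sm: "semimetric_space X d" and K\<^sub>1: "K\<^sub>1 \<ge> 1"
        and rpi: "relaxed_polygonal_ineq K\<^sub>1 X d"
        by (auto simp: property_P_def)
      obtain K\<^sub>2 where K\<^sub>2: "K\<^sub>2 \<ge> 1" "?maps K\<^sub>1 K\<^sub>2"
        using maps K\<^sub>1 by blast
      have "relaxed_polygonal_ineq K\<^sub>2 X (\<lambda>x y. f (d x y))"
        by (rule relaxed_polygonal_ineq_comp[OF sm rpi _ K\<^sub>1 K\<^sub>2(1)]) (use K\<^sub>2(2) in blast)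
      moreover have "semimetric_space X (\<lambda>x y. f (d x y))"
        using sm assms(1) f0 by (simp add: semimetric_space_def)
      ultimately show "semimetric_space X (\<lambda>x y. f (d x y)) \<and> property_P X (\<lambda>x y. f (d x y))"
        using K\<^sub>2(1) by (auto simp: property_P_def)
    qed
  qed
qed

end
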